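(* Let $0\le s<\frac12$. For $\beta>0$ small, with $\alpha=\sqrt{1-\beta^2}$ and $B_0(x,t;\beta,0,0)=4\arctan\Big(\frac\beta\alpha\frac{\cos(\alpha t)}{\cosh(\beta x)}\Big)$, one has at $t=\frac{\pi}{2\alpha}$ $$\Big\|\Big(B_0\big(\cdot,\tfrac{\pi}{2\alpha};\beta,0,0\big),\ \partial_tB_0\big(\cdot,\tfrac{\pi}{2\alpha};\beta,0,0\big)\Big)\Big\|_{H^{1,s}_{\sin}\times L^{2,s}}\sim\beta^{\frac12-s}.$$ In particular, asymptotic stability of the zero solution of the sine-Gordon equation $\partial_{tt}f-\partial_{xx}f+\sin f=0$ fails for initial perturbations in $H^{1,s}_{\sin}(\mathbb{R})\times L^{2,s}(\mathbb{R})$ with $0\le s<\frac12$.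
   Context: $\langle x\rangle=(1+x^2)^{1/2}$; $\|g\|_{L^{2,s}}=\|\langle x\rangle^sg\|_{L^2}$; the size of $(g_1,g_2)$ in $H^{1,s}_{\sin}\times L^{2,s}$ is $$\big(\|\sin(g_1/2)\|_{L^{2,s}}^2+\|\partial_xg_1\|_{L^{2,s}}^2+\|g_2\|_{L^{2,s}}^2\big)^{1/2}.$$ $B_0(x,t;\beta,0,0)$ is a (zero-velocity breather) solution of the sine-Gordon equation. $A\sim B$ means $C^{-1}B\le A\le CB$ with $C>0$ depending only on $s$. Failure of asymptotic stability of the zero solution means that arbitrarily small perturbations can produce new non-decaying components: for every $\varepsilon>0$ there are initial data of size less than $\varepsilon$ in $H^{1,s}_{\sin}\times L^{2,s}$ whose solution $f$ does not satisfy $\lim_{t\to\infty}\int_{|x-\mathfrak vt|<\mathfrak L}(|f|^2+|f_x|^2+|f_t|^2)\,dx=0$ for all $\mathfrak v\in\mathbb{R}$, $\mathfrak L>0$. *)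

theory Defs
  imports "HOL-Analysis.Analysis"
begin

definition japanese :: "real \<Rightarrow> real" where
  "japanese x = sqrt (1 + x\<^sup>2)"

definition L2s :: "real \<Rightarrow> (real \<Rightarrow> real) set" where
  "L2s s = {g. g \<in> borel_measurable lebesgue \<and>
               integrable lebesgue (\<lambda>x. (japanese x powr s * g x)\<^sup>2)}"

definition L2s_norm :: "real \<Rightarrow> (real \<Rightarrow> real) \<Rightarrow> real" where
  "L2s_norm s g = sqrt (LINT x|lebesgue. (japanese x powr s * g x)\<^sup>2)"

text \<open>Weak derivatives on the line, tested against compactly supported \<open>C\<^sup>1\<close> functions
  (as in Brezis; this gives the same notion as smooth test functions).\<close>

definition test_function :: "(real \<Rightarrow> real) \<Rightarrow> bool" where
  "test_function \<phi> \<longleftrightarrow> \<phi> C1_differentiable_on UNIV \<and> compact (closure {x. \<phi> x \<noteq> 0})"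

definition locally_integrable :: "(real \<Rightarrow> real) \<Rightarrow> bool" where
  "locally_integrable g \<longleftrightarrow> (\<forall>a b. g absolutely_integrable_on {a..b})"

definition has_weak_deriv :: "(real \<Rightarrow> real) \<Rightarrow> (real \<Rightarrow> real) \<Rightarrow> bool" where
  "has_weak_deriv g h \<longleftrightarrow> locally_integrable g \<and> locally_integrable h \<and>
     (\<forall>\<phi>. test_function \<phi> \<longrightarrow>
        (LINT x|lebesgue. g x * deriv \<phi> x) = - (LINT x|lebesgue. h x * \<phi> x))"

text \<open>The weak derivative is determined only up to a null set; the choice of a representative
  affects neither membership in the spaces below nor the value of the norms.\<close>

definition weak_deriv :: "(real \<Rightarrow> real) \<Rightarrow> real \<Rightarrow> real" where
  "weak_deriv g = (SOME h. has_weak_deriv g h)"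

definition H1s_sin :: "real \<Rightarrow> (real \<Rightarrow> real) set" where
  "H1s_sin s = {g. (\<exists>h. has_weak_deriv g h) \<and> (\<lambda>x. sin (g x / 2)) \<in> L2s s \<and>
                   weak_deriv g \<in> L2s s}"

definition data_size :: "real \<Rightarrow> (real \<Rightarrow> real) \<times> (real \<Rightarrow> real) \<Rightarrow> real" where
  "data_size s = (\<lambda>(g1, g2).
     sqrt ((L2s_norm s (\<lambda>x. sin (g1 x / 2)))\<^sup>2 + (L2s_norm s (weak_deriv g1))\<^sup>2
           + (L2s_norm s g2)\<^sup>2))"

text \<open>Functions on space-time take the space variable first and the time variable second.\<close>

definition dx :: "(real \<Rightarrow> real \<Rightarrow> real) \<Rightarrow> real \<Rightarrow> real \<Rightarrow> real" where
  "dx f x t = deriv (\<lambda>y. f y t) x"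

definition dt :: "(real \<Rightarrow> real \<Rightarrow> real) \<Rightarrow> real \<Rightarrow> real \<Rightarrow> real" where
  "dt f x t = deriv (\<lambda>\<tau>. f x \<tau>) t"

definition C1_plane :: "(real \<Rightarrow> real \<Rightarrow> real) \<Rightarrow> bool" where
  "C1_plane f \<longleftrightarrow>
     (\<forall>x t. (\<lambda>y. f y t) field_differentiable at x \<and> (\<lambda>\<tau>. f x \<tau>) field_differentiable at t) \<and>
     continuous_on UNIV (\<lambda>(x, t). f x t) \<and>
     continuous_on UNIV (\<lambda>(x, t). dx f x t) \<and>
     continuous_on UNIV (\<lambda>(x, t). dt f x t)"

definition C2_plane :: "(real \<Rightarrow> real \<Rightarrow> real) \<Rightarrow> bool" where
  "C2_plane f \<longleftrightarrow> C1_plane f \<and> C1_plane (dx f) \<and> C1_plane (dt f)"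

text \<open>Classical solutions, global in time. A classical solution is determined by its
  data at time \<open>0\<close> and is also a solution in every weaker (energy, distributional) sense, so
  exhibiting a non-decaying one is the strongest form of instability.\<close>

definition sine_gordon :: "(real \<Rightarrow> real \<Rightarrow> real) \<Rightarrow> bool" where
  "sine_gordon f \<longleftrightarrow> C2_plane f \<and>
     (\<forall>x t. dt (dt f) x t - dx (dx f) x t + sin (f x t) = 0)"

definition sine_gordon_solution ::
    "(real \<Rightarrow> real) \<times> (real \<Rightarrow> real) \<Rightarrow> (real \<Rightarrow> real \<Rightarrow> real) \<Rightarrow> bool" where
  "sine_gordon_solution = (\<lambda>(g1, g2) f. sine_gordon f \<and>
     (\<forall>x. f x 0 = g1 x) \<and> (\<forall>x. dt f x 0 = g2 x))"

definition local_energy :: "(real \<Rightarrow> real \<Rightarrow> real) \<Rightarrow> real \<Rightarrow> real \<Rightarrow> real \<Rightarrow> real" where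
  "local_energy f v L t =
     (LINT x:{x. \<bar>x - v * t\<bar> < L}|lebesgue. (f x t)\<^sup>2 + (dx f x t)\<^sup>2 + (dt f x t)\<^sup>2)"

definition locally_decaying :: "(real \<Rightarrow> real \<Rightarrow> real) \<Rightarrow> bool" where
  "locally_decaying f \<longleftrightarrow> (\<forall>v. \<forall>L>0. (local_energy f v L \<longlongrightarrow> 0) at_top)"

definition breather_freq :: "real \<Rightarrow> real" where
  "breather_freq \<beta> = sqrt (1 - \<beta>\<^sup>2)"

definition breather :: "real \<Rightarrow> real \<Rightarrow> real \<Rightarrow> real" where
  "breather \<beta> x t =
     4 * arctan (\<beta> / breather_freq \<beta> * (cos (breather_freq \<beta> * t) / cosh (\<beta> * x)))"

definition breather_data :: "real \<Rightarrow> real \<Rightarrow> (real \<Rightarrow> real) \<times> (real \<Rightarrow> real)" where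
  "breather_data \<beta> t = ((\<lambda>x. breather \<beta> x t), (\<lambda>x. dt (breather \<beta>) x t))"

end

theory Submission
  imports Defs "HOL-Probability.Sinc_Integral" "HOL-Real_Asymp.Real_Asymp"
begin

text \<open>
  At time \<open>\<pi> / (2 \<alpha>)\<close> the breather passes through zero, so its data are
  \<open>(0, - 4 \<beta> / cosh (\<beta> x))\<close> and the squared size is the weighted integral
  \<open>16 \<beta>\<^sup>2 \<integral> (1 + x\<^sup>2)\<^sup>s / cosh\<^sup>2 (\<beta> x) dx\<close>. Since the mass sits at
  \<open>\<bar>x\<bar> \<approx> 1 / \<beta>\<close>, where the weight is \<open>\<beta>\<close> to the power \<open>- 2 s\<close>, the integral is of order
  \<open>\<beta>\<close> to the power \<open>1 - 2 s\<close>, which tends to \<open>0\<close> for \<open>s < 1 / 2\<close>. The breather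
  started at this time is periodic, so its energy near the origin does not decay.
\<close>

subsection \<open>Weak derivatives of zero\<close>

text \<open>Away from \<open>0\<close> the function is locally \<open>0\<close> or
  \<open>y\<^sup>2\<close>, and at \<open>0\<close> its difference quotient is at most
  \<open>\<bar>h\<bar>\<close>.\<close>

lemma DERIV_max_0_power2:
  fixes y :: real
  shows "((\<lambda>y. (max 0 y)\<^sup>2) has_real_derivative 2 * max 0 y) (at y)"
proof (cases y "0::real" rule: linorder_cases)
  case less
  have "((\<lambda>y. 0) has_real_derivative 2 * max 0 y) (at y)"
    using less by simp
  then show ?thesis
    by (rule has_field_derivative_transform_within_open[where S = "{..<0}"]) (use less in auto)
next
  case equal
  have "((\<lambda>h. (max 0 h)\<^sup>2 / h) \<longlongrightarrow> 0) (at (0::real))"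
  proof (rule Lim_null_comparison)
    show "\<forall>\<^sub>F h in at (0::real). norm ((max 0 h)\<^sup>2 / h) \<le> \<bar>h\<bar>"
      by (rule always_eventually) (auto simp: max_def power2_eq_square)
    show "((\<lambda>h. \<bar>h\<bar>) \<longlongrightarrow> 0) (at (0::real))"
      by (rule tendsto_eq_intros | simp)+
  qed
  then show ?thesis
    using equal by (simp add: has_field_derivative_iff)
next
  case greater
  have "((\<lambda>y. y\<^sup>2) has_real_derivative 2 * max 0 y) (at y)"
    using greater by (auto intro!: derivative_eq_intros)
  then show ?thesis
    by (rule has_field_derivative_transform_within_open[where S = "{0<..}"]) (use greater in auto)
qed

text \<open>\<open>C\<^sup>1\<close> functions converging to the indicator of \<open>{a<..<b}\<close>; squaring the positive part
  makes it continuously differentiable.\<close>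

definition bump :: "real \<Rightarrow> real \<Rightarrow> nat \<Rightarrow> real \<Rightarrow> real" where
  "bump a b n x = (let w = (max 0 ((x - a) * (b - x)))\<^sup>2 in n * w / (1 + n * w))"

lemma bump_denominator_pos: "1 + real n * (max 0 u)\<^sup>2 > 0"
  by (simp add: add_pos_nonneg)

lemma bump_bounds: "0 \<le> bump a b n x" "bump a b n x \<le> 1"
  using bump_denominator_pos[of n "(x - a) * (b - x)"] by (auto simp: bump_def Let_def field_simps)

lemma bump_outside: "x \<notin> {a<..<b} \<Longrightarrow> a \<le> b \<Longrightarrow> bump a b n x = 0"
proof -
  assume "x \<notin> {a<..<b}" "a \<le> b"
  then have "(x - a) * (b - x) \<le> 0"
    by (auto simp: mult_le_0_iff)
  then show ?thesis by (simp add: bump_def max_def)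
qed

text \<open>At an interior point \<open>w\<close> is positive and independent of \<open>n\<close>,
  so the quotient tends to \<open>1\<close>; elsewhere every term is \<open>0\<close>.\<close>

lemma bump_tendsto_indicator:
  assumes "a \<le> b"
  shows "(\<lambda>n. bump a b n x) \<longlonglongrightarrow> indicator {a<..<b} x"
proof (cases "x \<in> {a<..<b}")
  case False
  then show ?thesis using bump_outside[OF False assms] by simp
next
  case True
  define w where "w = (max 0 ((x - a) * (b - x)))\<^sup>2"
  have "(x - a) * (b - x) > 0" using True by (intro mult_pos_pos) auto
  then have "w = ((x - a) * (b - x))\<^sup>2" "((x - a) * (b - x))\<^sup>2 > 0"
    by (simp_all only: w_def max.absorb4 zero_less_power)
  then have w: "w > 0" by simp
  have "(\<lambda>n. real n * w / (1 + real n * w)) \<longlonglongrightarrow> 1"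
    using w by real_asymp
  then show ?thesis using True by (simp add: bump_def Let_def w_def)
qed

lemma test_function_bump:
  assumes "a \<le> b"
  shows "test_function (bump a b n)"
proof -
  define m where "m x = max 0 ((x - a) * (b - x))" for x
  \<comment> \<open>The quotient rule with \<open>w = (m x)\<^sup>2\<close>: the products of
    \<open>w\<close> with its own derivative cancel in the numerator, leaving \<open>n\<close> times
    the derivative of \<open>w\<close>.\<close>
  define D where "D x = real n * (2 * m x * (a + b - 2 * x)) / (1 + real n * (m x)\<^sup>2)\<^sup>2" for x
  have pos: "1 + real n * (m x)\<^sup>2 \<noteq> 0" for x
    unfolding m_def using bump_denominator_pos[of n] by (metis less_irrefl)
  have sq: "((\<lambda>x. (m x)\<^sup>2) has_real_derivative 2 * m x * (a + b - 2 * x)) (at x)" for x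
    unfolding m_def
    by (rule DERIV_chain2[OF DERIV_max_0_power2]) (auto intro!: derivative_eq_intros)
  have "(bump a b n has_real_derivative D x) (at x)" for x
  proof -
    have "((\<lambda>x. real n * (m x)\<^sup>2 / (1 + real n * (m x)\<^sup>2)) has_real_derivative D x) (at x)"
      unfolding D_def
      using DERIV_divide[OF DERIV_cmult[OF sq, of "real n"]
          DERIV_add[OF DERIV_const DERIV_cmult[OF sq, of "real n"]] pos]
      by (rule DERIV_cong) (simp add: power2_eq_square algebra_simps)
    then show ?thesis
      by (simp add: bump_def[abs_def] m_def Let_def)
  qed
  moreover have "continuous_on UNIV D"
    unfolding D_def m_def
    by (intro continuous_intros) (use pos[unfolded m_def] in auto)
  ultimately have "bump a b n C1_differentiable_on UNIV"
    unfolding C1_differentiable_on_def has_real_derivative_iff_has_vector_derivative by blast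
  moreover have "{x. bump a b n x \<noteq> 0} \<subseteq> {a..b}"
    using bump_outside[OF _ assms, of _ n]
    by (smt (verit) atLeastAtMost_iff greaterThanLessThan_iff mem_Collect_eq subsetI)
  then have "compact (closure {x. bump a b n x \<noteq> 0})"
    by (meson bounded_closed_interval bounded_subset compact_closure)
  ultimately show ?thesis by (simp add: test_function_def)
qed

section \<open>Functions with vanishing interval integrals\<close>

text \<open>After truncation to \<open>{- real n<..<real n}\<close> the function is integrable.
  Half-lines are stable under intersection and generate the Borel sets, so its integral vanishes
  over every Borel set.\<close>

lemma AE_zero_if_interval_integrals_zero:
  fixes h :: "real \<Rightarrow> real"
  assumes loc: "locally_integrable h"
    and zero: "\<And>a b. a \<le> b \<Longrightarrow> (LINT x:{a<..<b}|lebesgue. h x) = 0"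
  shows "AE x in lebesgue. h x = 0"
proof -
  have N: "AE x in lebesgue. indicator {- real n<..<real n} x * h x = 0" for n :: nat
  proof -
    define I where "I = {- real n<..<real n}"
    have "h absolutely_integrable_on I"
      using loc by (intro set_integrable_subset[of lebesgue "{- real n..real n}" h I])
        (auto simp: locally_integrable_def I_def)
    then have int: "integrable lebesgue (\<lambda>x. indicator I x * h x)"
      by (simp add: set_integrable_def)
    \<comment> \<open>The generator argument concerns Borel sets, so the Lebesgue measurable
      truncation is replaced by a Borel function equal to it almost everywhere.\<close>
    obtain k where k: "k \<in> borel_measurable lborel" "AE x in lborel. indicator I x * h x = k x"
      using completion_ex_borel_measurable_real[OF borel_measurable_integrable[OF int]] by auto
    have kL: "AE x in lebesgue. indicator I x * h x = k x"
      using k(2) by (rule AE_completion)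
    have km: "k \<in> borel_measurable lebesgue"
      using k(1) by (rule measurable_completion)
    have "integrable lebesgue k"
      using integrable_cong_AE[OF borel_measurable_integrable[OF int] km kL] int by simp
    then have ki: "integrable lborel k"
      using integrable_completion[OF k(1)] by simp
    have tr: "(LINT x:A|lborel. k x) = (LINT x|lebesgue. indicator A x * (indicator I x * h x))"
      if A: "A \<in> sets borel" for A
    proof -
      have Ak: "(\<lambda>x. indicator A x * k x) \<in> borel_measurable lborel"
        using A k(1) by measurable
      have "(LINT x:A|lborel. k x) = (LINT x|lebesgue. indicator A x * k x)"
        unfolding set_lebesgue_integral_def using integral_completion[OF Ak] by simp
      also have "\<dots> = (LINT x|lebesgue. indicator A x * (indicator I x * h x))"
        using kL A
        by (intro integral_cong_AE measurable_completion[OF Ak] borel_measurable_times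
            borel_measurable_integrable[OF int] borel_measurable_indicator) auto
      finally show ?thesis .
    qed
    have lt: "(LINT x:{..<c}|lborel. k x) = 0" for c
    proof -
      \<comment> \<open>Clamping \<open>c\<close> to the window keeps
        \<open>- real n \<le> d\<close>; for \<open>c\<close> left of the window the interval is
        empty.\<close>
      define d where "d = max (- real n) (min c (real n))"
      have "{..<c} \<inter> I = {- real n<..<d}"
        by (auto simp: I_def d_def)
      then have "(\<lambda>x. indicator {..<c} x * (indicator I x * h x)) = (\<lambda>x. indicator {- real n<..<d} x *\<^sub>R h x)"
        by (metis (no_types, lifting) ext indicator_inter_arith mult.assoc real_scaleR_def)
      moreover have "- real n \<le> d" by (simp add: d_def)
      ultimately show ?thesis
        using zero[of "- real n" d] tr[of "{..<c}"] by (simp only: set_lebesgue_integral_def) simp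
    qed
    \<comment> \<open>The integral over the whole line is what the complement case of the induction
      below subtracts from.\<close>
    have tot: "(LINT x|lborel. k x) = 0"
      using tr[of UNIV] zero[of "- real n" "real n"]
      by (simp add: set_lebesgue_integral_def I_def)
    have "(LINT x:A|lborel. k x) = 0" if "A \<in> sets lborel" for A
    proof -
      have "Int_stable (range lessThan :: real set set)"
      proof (rule Int_stableI, elim rangeE)
        fix A B and a b :: real
        assume "A = {..<a}" "B = {..<b}"
        then have "A \<inter> B = {..<min a b}" by auto
        then show "A \<inter> B \<in> range lessThan" by (rule range_eqI)
      qed
      moreover have "range lessThan \<subseteq> Pow (UNIV :: real set)" by simp
      moreover have "A \<in> sigma_sets UNIV (range lessThan)"
        using that by (simp add: borel_Iio)
      ultimately show ?thesis
      proof (induction rule: sigma_sets_induct_disjoint[consumes 3, case_names basic empty compl union])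
        case (compl B)
        then have B: "B \<in> sets lborel" by (simp add: borel_Iio)
        have "(LINT x:UNIV - B|lborel. k x) = (LINT x|lborel. k x - indicator B x *\<^sub>R k x)"
          unfolding set_lebesgue_integral_def
          by (intro Bochner_Integration.integral_cong) (auto simp: indicator_def)
        also have "\<dots> = (LINT x|lborel. k x) - (LINT x|lborel. indicator B x *\<^sub>R k x)"
          by (intro Bochner_Integration.integral_diff ki integrable_mult_indicator B)
        also have "\<dots> = 0"
          using tot compl(2) by (simp add: set_lebesgue_integral_def)
        finally show ?case .
      next
        case (union B)
        then have B: "B i \<in> sets lborel" for i by (auto simp: borel_Iio)
        have U: "set_integrable lborel (\<Union>i. B i) k"
          unfolding set_integrable_def
          by (intro integrable_mult_indicator ki sets.countable_UN) (use B in blast)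
        have "(LINT x:(\<Union>i. B i)|lborel. k x) = (\<Sum>i. LINT x:B i|lborel. k x)"
          by (rule lebesgue_integral_countable_add[OF B _ U])
            (use union(1) in \<open>auto simp: disjoint_family_on_def\<close>)
        then show ?case using union(3) by simp
      next
        case (basic B)
        then show ?case using lt by blast
      qed (simp add: set_lebesgue_integral_def)
    qed
    \<comment> \<open>\<open>k\<close> and \<open>0\<close> have equal integrals over all Borel
      sets, hence agree almost everywhere as densities.\<close>
    then have "AE x in lborel. k x = 0"
      using density_unique_real[OF ki, of "\<lambda>_. 0"] by (simp add: set_lebesgue_integral_def)
    then have "AE x in lebesgue. k x = 0" by (rule AE_completion)
    with kL show ?thesis by (auto simp: I_def)
  qed
  have "AE x in lebesgue. \<forall>n::nat. indicator {- real n<..<real n} x * h x = 0"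
    unfolding AE_all_countable using N by blast
  then show ?thesis
  proof (rule AE_mp, intro AE_I2 impI)
    fix x assume *: "\<forall>n::nat. indicator {- real n<..<real n} x * h x = 0"
    obtain n :: nat where "\<bar>x\<bar> < real n" using reals_Archimedean2 by blast
    then have "x \<in> {- real n<..<real n}" by auto
    then show "h x = 0" using * by (metis indicator_simps(1) mult_1)
  qed
qed

text \<open>Testing against \<open>bump a b n\<close> gives \<open>0\<close> for every
  \<open>n\<close>, and dominated convergence turns this into a vanishing integral over
  \<open>{a<..<b}\<close>.\<close>

lemma weak_deriv_zero_AE:
  assumes "has_weak_deriv (\<lambda>_. 0) h"
  shows "AE x in lebesgue. h x = 0"
proof (rule AE_zero_if_interval_integrals_zero)
  show loc: "locally_integrable h"
    using assms by (simp add: has_weak_deriv_def)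
  fix a b :: real assume ab: "a \<le> b"
  have int: "integrable lebesgue (\<lambda>x. indicator {a..b} x * h x)"
    using loc by (simp add: locally_integrable_def set_integrable_def)
  \<comment> \<open>Since \<open>h\<close> is only locally integrable, the indicator is inserted to
    obtain an integrable majorant.\<close>
  have eq: "h x * bump a b n x = bump a b n x * (indicator {a..b} x * h x)" for n x
    using bump_outside[OF _ ab, of x n] by (cases "x \<in> {a..b}") auto
  have bm: "bump a b n \<in> borel_measurable lebesgue" for n
  proof -
    have "continuous_on UNIV (bump a b n)"
      using test_function_bump[OF ab] C1_differentiable_imp_continuous_on test_function_def by blast
    then show ?thesis
      by (intro measurable_completion) (simp add: borel_measurable_continuous_onI)
  qed
  have lim: "(\<lambda>n. LINT x|lebesgue. h x * bump a b n x) \<longlonglongrightarrow> (LINT x|lebesgue. indicator {a<..<b} x * (indicator {a..b} x * h x))"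
    unfolding eq
  proof (rule integral_dominated_convergence[where w = "\<lambda>x. \<bar>indicator {a..b} x * h x\<bar>"])
    show "integrable lebesgue (\<lambda>x. \<bar>indicator {a..b} x * h x\<bar>)" using int by (rule integrable_abs)
    show "AE x in lebesgue. (\<lambda>n. bump a b n x * (indicator {a..b} x * h x)) \<longlonglongrightarrow> indicator {a<..<b} x * (indicator {a..b} x * h x)"
      by (intro AE_I2 tendsto_mult bump_tendsto_indicator ab tendsto_const)
    show "AE x in lebesgue. norm (bump a b n x * (indicator {a..b} x * h x)) \<le> \<bar>indicator {a..b} x * h x\<bar>" for n
      using bump_bounds[of a b n] by (intro AE_I2) (simp add: abs_mult mult_left_le_one_le)
  qed (use bm borel_measurable_integrable[OF int] in \<open>auto intro!: borel_measurable_times borel_measurable_indicator\<close>)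
  moreover have "(LINT x|lebesgue. h x * bump a b n x) = 0" for n
    using assms test_function_bump[OF ab, of n] by (simp add: has_weak_deriv_def)
  ultimately have "(LINT x|lebesgue. indicator {a<..<b} x * (indicator {a..b} x * h x)) = 0"
    by (simp add: LIMSEQ_const_iff)
  moreover have "indicator {a<..<b} x * (indicator {a..b} x * h x) = indicator {a<..<b} x *\<^sub>R h x" for x
    by (simp add: indicator_def)
  ultimately show "(LINT x:{a<..<b}|lebesgue. h x) = 0"
    by (simp add: set_lebesgue_integral_def)
qed

lemma has_weak_deriv_zero: "has_weak_deriv (\<lambda>_. 0) (\<lambda>_. 0)"
  by (simp add: has_weak_deriv_def locally_integrable_def)

text \<open>\<open>weak_deriv\<close> is an arbitrary choice, so its value at the zero function is
  known only almost everywhere; membership and norm are insensitive to null sets.\<close>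

lemma weak_deriv_zero:
  "weak_deriv (\<lambda>_. 0) \<in> L2s s" "L2s_norm s (weak_deriv (\<lambda>_. 0)) = 0"
proof -
  define h where "h = weak_deriv (\<lambda>_. 0)"
  have h: "has_weak_deriv (\<lambda>_. 0) h"
    unfolding h_def weak_deriv_def using has_weak_deriv_zero by (metis someI_ex)
  then have ae: "AE x in lebesgue. (japanese x powr s * h x)\<^sup>2 = 0"
    using weak_deriv_zero_AE by fastforce
  \<comment> \<open>Local integrability yields measurability of the truncations, whose pointwise
    limit is \<open>h\<close>.\<close>
  have hm: "h \<in> borel_measurable lebesgue"
  proof (rule borel_measurable_LIMSEQ_real)
    show "(\<lambda>x. indicator {- real n..real n} x * h x) \<in> borel_measurable lebesgue" for n
      using h borel_measurable_integrable[of lebesgue "\<lambda>x. indicator {- real n..real n} x * h x"]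
      by (simp add: has_weak_deriv_def locally_integrable_def set_integrable_def)
    fix x
    obtain N :: nat where "\<bar>x\<bar> < real N" using reals_Archimedean2 by blast
    then have "\<forall>n\<ge>N. indicator {- real n..real n} x * h x = h x"
      by (auto simp: indicator_def)
    then show "(\<lambda>n. indicator {- real n..real n} x * h x) \<longlonglongrightarrow> h x"
      by (intro tendsto_eventually) (auto simp: eventually_sequentially)
  qed
  have "(\<lambda>x. japanese x powr s) \<in> borel_measurable lebesgue"
    unfolding japanese_def by (intro measurable_completion) measurable
  then have "(\<lambda>x. (japanese x powr s * h x)\<^sup>2) \<in> borel_measurable lebesgue"
    using hm by measurable
  then have "integrable lebesgue (\<lambda>x. (japanese x powr s * h x)\<^sup>2)"
    using integrable_cong_AE[OF _ _ ae] by simp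
  then show "weak_deriv (\<lambda>_. 0) \<in> L2s s" using hm by (simp add: L2s_def h_def)
  show "L2s_norm s (weak_deriv (\<lambda>_. 0)) = 0"
    using integral_eq_zero_AE[OF ae] by (simp add: L2s_norm_def h_def)
qed

subsection \<open>The breather with arbitrary phase solves the sine-Gordon equation\<close>

text \<open>Equality as functions lets the closed forms be rewritten under a further
  \<open>dx\<close> or \<open>dt\<close>.\<close>

lemma
  fixes f fx ft :: "real \<Rightarrow> real \<Rightarrow> real"
  assumes "\<And>x t. ((\<lambda>y. f y t) has_real_derivative fx x t) (at x)"
    and "\<And>x t. (f x has_real_derivative ft x t) (at t)"
  shows dx_eqI: "dx f = fx" and dt_eqI: "dt f = ft"
  using assms by (auto simp: dx_def dt_def fun_eq_iff intro!: DERIV_imp_deriv)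

lemma C1_planeI:
  fixes f fx ft :: "real \<Rightarrow> real \<Rightarrow> real"
  assumes x: "\<And>x t. ((\<lambda>y. f y t) has_real_derivative fx x t) (at x)"
    and t: "\<And>x t. (f x has_real_derivative ft x t) (at t)"
    and "continuous_on UNIV (\<lambda>p. f (fst p) (snd p))"
    and "continuous_on UNIV (\<lambda>p. fx (fst p) (snd p))"
    and "continuous_on UNIV (\<lambda>p. ft (fst p) (snd p))"
  shows "C1_plane f"
  unfolding C1_plane_def dx_eqI[OF x t] dt_eqI[OF x t] case_prod_beta'
  using assms(3-5) x t by (auto simp only: field_differentiable_def intro!: exI)

section \<open>The wave and its partial derivatives in closed form\<close>

text \<open>The breather with a phase, which allows the zero crossing to be moved to time
  \<open>0\<close>. Frequency and width are independent parameters until the equation is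
  verified.\<close>

definition wave :: "real \<Rightarrow> real \<Rightarrow> real \<Rightarrow> real \<Rightarrow> real \<Rightarrow> real" where
  "wave a b \<theta> x t = 4 * arctan (b / a * (cos (a * t + \<theta>) / cosh (b * x)))"

text \<open>This is \<open>1 + u\<^sup>2\<close>, with \<open>u\<close> the argument of the
  arctangent, multiplied by \<open>(a * cosh (b * x))\<^sup>2\<close>. It is positive for
  \<open>a > 0\<close>, so the closed forms below have no singularities.\<close>

definition wave_denom :: "real \<Rightarrow> real \<Rightarrow> real \<Rightarrow> real \<Rightarrow> real \<Rightarrow> real" where
  "wave_denom a b \<theta> x t = b\<^sup>2 * (cos (a * t + \<theta>))\<^sup>2 + a\<^sup>2 * (cosh (b * x))\<^sup>2"

definition wave_x where
  "wave_x a b \<theta> x t = - 4 * a * b\<^sup>2 * cos (a * t + \<theta>) * sinh (b * x) / wave_denom a b \<theta> x t"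

definition wave_t where
  "wave_t a b \<theta> x t = - 4 * a\<^sup>2 * b * sin (a * t + \<theta>) * cosh (b * x) / wave_denom a b \<theta> x t"

definition wave_xx where
  "wave_xx a b \<theta> x t = - 4 * a * b ^ 3 * cos (a * t + \<theta>) * cosh (b * x)
     * (wave_denom a b \<theta> x t - 2 * a\<^sup>2 * (sinh (b * x))\<^sup>2) / (wave_denom a b \<theta> x t)\<^sup>2"

text \<open>One formula for both orders of differentiation, in the shape obtained by differentiating
  \<open>wave_x\<close> in time.\<close>

definition wave_xt where
  "wave_xt a b \<theta> x t = 4 * a\<^sup>2 * b\<^sup>2 * sin (a * t + \<theta>) * sinh (b * x)
     * (wave_denom a b \<theta> x t - 2 * b\<^sup>2 * (cos (a * t + \<theta>))\<^sup>2) / (wave_denom a b \<theta> x t)\<^sup>2"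

definition wave_tt where
  "wave_tt a b \<theta> x t = - 4 * a ^ 3 * b * cos (a * t + \<theta>) * cosh (b * x)
     * (wave_denom a b \<theta> x t + 2 * b\<^sup>2 * (sin (a * t + \<theta>))\<^sup>2) / (wave_denom a b \<theta> x t)\<^sup>2"

context
  fixes a b :: real
  assumes a: "a > 0"
begin

lemma wave_denom_pos: "wave_denom a b \<theta> x t > 0"
  using a by (simp add: wave_denom_def add_nonneg_pos)

lemma wave_denom_nonzero [simp]: "wave_denom a b \<theta> x t \<noteq> 0"
  using wave_denom_pos by (metis less_irrefl)

lemma DERIV_wave_denom_x:
  "((\<lambda>y. wave_denom a b \<theta> y t) has_real_derivative 2 * a\<^sup>2 * b * cosh (b * x) * sinh (b * x)) (at x)"
  unfolding wave_denom_def by (auto intro!: derivative_eq_intros simp: field_simps)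

lemma DERIV_wave_denom_t:
  "(wave_denom a b \<theta> x has_real_derivative
     - 2 * a * b\<^sup>2 * cos (a * t + \<theta>) * sin (a * t + \<theta>)) (at t)"
  unfolding wave_denom_def[abs_def] by (auto intro!: derivative_eq_intros simp: field_simps)

lemma one_plus_wave_arg_square:
  "1 + (b / a * (cos (a * t + \<theta>) / cosh (b * x)))\<^sup>2
     = wave_denom a b \<theta> x t / (a * cosh (b * x))\<^sup>2"
  using a by (simp add: wave_denom_def field_simps)

lemma DERIV_wave_x:
  "((\<lambda>y. wave a b \<theta> y t) has_real_derivative wave_x a b \<theta> x t) (at x)"
proof -
  have "((\<lambda>y. b / a * (cos (a * t + \<theta>) / cosh (b * y))) has_real_derivative
     - (b\<^sup>2 / a) * cos (a * t + \<theta>) * sinh (b * x) / (cosh (b * x))\<^sup>2) (at x)"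
    using a by (auto intro!: derivative_eq_intros simp: field_simps power2_eq_square)
  from DERIV_cmult[OF DERIV_chain2[OF DERIV_arctan this], of 4]
  show ?thesis
    unfolding wave_def one_plus_wave_arg_square
    by (rule DERIV_cong) (use a in \<open>simp add: wave_x_def field_simps power2_eq_square\<close>)
qed

lemma DERIV_wave_t:
  "(wave a b \<theta> x has_real_derivative wave_t a b \<theta> x t) (at t)"
proof -
  have "((\<lambda>t. b / a * (cos (a * t + \<theta>) / cosh (b * x))) has_real_derivative
     - b * sin (a * t + \<theta>) / cosh (b * x)) (at t)"
    using a by (auto intro!: derivative_eq_intros simp: field_simps)
  from DERIV_cmult[OF DERIV_chain2[OF DERIV_arctan this], of 4]
  show ?thesis
    unfolding wave_def[abs_def] one_plus_wave_arg_square
    by (rule DERIV_cong) (use a in \<open>simp add: wave_t_def field_simps power2_eq_square\<close>)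
qed

lemma DERIV_wave_xx:
  "((\<lambda>y. wave_x a b \<theta> y t) has_real_derivative wave_xx a b \<theta> x t) (at x)"
proof -
  have n: "((\<lambda>y. - 4 * a * b\<^sup>2 * cos (a * t + \<theta>) * sinh (b * y)) has_real_derivative
      - 4 * a * b ^ 3 * cos (a * t + \<theta>) * cosh (b * x)) (at x)"
    by (auto intro!: derivative_eq_intros simp: power2_eq_square power3_eq_cube)
  show ?thesis
    unfolding wave_x_def
    by (rule DERIV_cong[OF DERIV_divide[OF n DERIV_wave_denom_x wave_denom_nonzero]])
       (simp add: wave_xx_def power2_eq_square power3_eq_cube algebra_simps)
qed

lemma DERIV_wave_xt:
  "(wave_x a b \<theta> x has_real_derivative wave_xt a b \<theta> x t) (at t)"
proof -
  have n: "((\<lambda>t. - 4 * a * b\<^sup>2 * cos (a * t + \<theta>) * sinh (b * x)) has_real_derivative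
      4 * a\<^sup>2 * b\<^sup>2 * sin (a * t + \<theta>) * sinh (b * x)) (at t)"
    by (auto intro!: derivative_eq_intros simp: power2_eq_square)
  show ?thesis
    unfolding wave_x_def[abs_def]
    by (rule DERIV_cong[OF DERIV_divide[OF n DERIV_wave_denom_t wave_denom_nonzero]])
       (simp add: wave_xt_def power2_eq_square algebra_simps)
qed

lemma DERIV_wave_tx:
  "((\<lambda>y. wave_t a b \<theta> y t) has_real_derivative wave_xt a b \<theta> x t) (at x)"
proof -
  have n: "((\<lambda>y. - 4 * a\<^sup>2 * b * sin (a * t + \<theta>) * cosh (b * y)) has_real_derivative
      - 4 * a\<^sup>2 * b\<^sup>2 * sin (a * t + \<theta>) * sinh (b * x)) (at x)"
    by (auto intro!: derivative_eq_intros simp: power2_eq_square)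
  \<comment> \<open>The denominator is the sum of its two squared terms, which reconciles the
    quotient rule in \<open>x\<close> with the form chosen for \<open>wave_xt\<close>.\<close>
  have "2 * a\<^sup>2 * (cosh (b * x))\<^sup>2 - wave_denom a b \<theta> x t
      = wave_denom a b \<theta> x t - 2 * b\<^sup>2 * (cos (a * t + \<theta>))\<^sup>2"
    by (simp add: wave_denom_def)
  then have "wave_xt a b \<theta> x t = 4 * a\<^sup>2 * b\<^sup>2 * sin (a * t + \<theta>) * sinh (b * x)
      * (2 * a\<^sup>2 * (cosh (b * x))\<^sup>2 - wave_denom a b \<theta> x t) / (wave_denom a b \<theta> x t)\<^sup>2"
    by (simp add: wave_xt_def)
  then show ?thesis
    unfolding wave_t_def
    by (intro DERIV_cong[OF DERIV_divide[OF n DERIV_wave_denom_x wave_denom_nonzero]])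
       (simp add: power2_eq_square algebra_simps)
qed

lemma DERIV_wave_tt:
  "(wave_t a b \<theta> x has_real_derivative wave_tt a b \<theta> x t) (at t)"
proof -
  have n: "((\<lambda>t. - 4 * a\<^sup>2 * b * sin (a * t + \<theta>) * cosh (b * x)) has_real_derivative
      - 4 * a ^ 3 * b * cos (a * t + \<theta>) * cosh (b * x)) (at t)"
    by (auto intro!: derivative_eq_intros simp: power2_eq_square power3_eq_cube)
  show ?thesis
    unfolding wave_t_def[abs_def]
    by (rule DERIV_cong[OF DERIV_divide[OF n DERIV_wave_denom_t wave_denom_nonzero]])
       (simp add: wave_tt_def power2_eq_square power3_eq_cube algebra_simps)
qed

lemma dx_wave: "dx (wave a b \<theta>) = wave_x a b \<theta>"
  and dt_wave: "dt (wave a b \<theta>) = wave_t a b \<theta>"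
  and dx_wave_x: "dx (wave_x a b \<theta>) = wave_xx a b \<theta>"
  and dt_wave_t: "dt (wave_t a b \<theta>) = wave_tt a b \<theta>"
  by (rule dx_eqI[OF DERIV_wave_x DERIV_wave_t] dt_eqI[OF DERIV_wave_x DERIV_wave_t]
      dx_eqI[OF DERIV_wave_xx DERIV_wave_xt] dt_eqI[OF DERIV_wave_tx DERIV_wave_tt])+

lemma continuous_on_wave_denom [continuous_intros]:
  fixes u v :: "'a::t2_space \<Rightarrow> real"
  assumes "continuous_on S u" "continuous_on S v"
  shows "continuous_on S (\<lambda>p. wave_denom a b \<theta> (u p) (v p))"
  unfolding wave_denom_def by (intro continuous_intros assms)

lemma continuous_on_wave [continuous_intros]:
  fixes u v :: "'a::t2_space \<Rightarrow> real"
  assumes "continuous_on S u" "continuous_on S v"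
  shows "continuous_on S (\<lambda>p. wave a b \<theta> (u p) (v p))"
    and "continuous_on S (\<lambda>p. wave_x a b \<theta> (u p) (v p))"
    and "continuous_on S (\<lambda>p. wave_t a b \<theta> (u p) (v p))"
    and "continuous_on S (\<lambda>p. wave_xx a b \<theta> (u p) (v p))"
    and "continuous_on S (\<lambda>p. wave_xt a b \<theta> (u p) (v p))"
    and "continuous_on S (\<lambda>p. wave_tt a b \<theta> (u p) (v p))"
  by (unfold wave_def wave_x_def wave_t_def wave_xx_def wave_xt_def wave_tt_def,
      (intro continuous_intros assms ballI; simp)+)

lemma C2_plane_wave: "C2_plane (wave a b \<theta>)"
  unfolding C2_plane_def dx_wave dt_wave
  by (intro conjI C1_planeI[OF DERIV_wave_x DERIV_wave_t] C1_planeI[OF DERIV_wave_xx DERIV_wave_xt]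
      C1_planeI[OF DERIV_wave_tx DERIV_wave_tt] continuous_intros)

section \<open>The sine-Gordon equation for the wave\<close>

text \<open>Two uses of the double-angle formula make the nonlinearity rational in \<open>u\<close>,
  so that the equation reduces to algebra.\<close>

lemma sin_4_arctan: "sin (4 * arctan u) = 4 * u * (1 - u\<^sup>2) / (1 + u\<^sup>2)\<^sup>2" for u :: real
proof -
  have r: "sqrt (1 + u\<^sup>2) * sqrt (1 + u\<^sup>2) = 1 + u\<^sup>2" "1 + u\<^sup>2 > 0"
    by (simp_all add: add_pos_nonneg)
  have s: "sin (2 * arctan u) = 2 * u / (1 + u\<^sup>2)"
    unfolding sin_double sin_arctan cos_arctan using r by simp
  have c: "cos (2 * arctan u) = (1 - u\<^sup>2) / (1 + u\<^sup>2)"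
    unfolding cos_double sin_arctan cos_arctan power_divide using r
    by (simp add: diff_divide_distrib)
  have "sin (4 * arctan u) = 2 * sin (2 * arctan u) * cos (2 * arctan u)"
    using sin_double[of "2 * arctan u"] by simp
  then show ?thesis
    by (simp add: s c power2_eq_square)
qed

lemma sin_wave:
  "sin (wave a b \<theta> x t) = 4 * a * b * cos (a * t + \<theta>) * cosh (b * x)
     * (a\<^sup>2 * (cosh (b * x))\<^sup>2 - b\<^sup>2 * (cos (a * t + \<theta>))\<^sup>2) / (wave_denom a b \<theta> x t)\<^sup>2"
proof -
  define C where "C = a * cosh (b * x)"
  define u where "u = b / a * (cos (a * t + \<theta>) / cosh (b * x))"
  have C: "C > 0" using a by (simp add: C_def)
  have u: "u = b * cos (a * t + \<theta>) / C" by (simp add: u_def C_def)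
  have 1: "1 + u\<^sup>2 = wave_denom a b \<theta> x t / C\<^sup>2"
    unfolding u_def C_def by (rule one_plus_wave_arg_square)
  have 2: "1 - u\<^sup>2 = (C\<^sup>2 - b\<^sup>2 * (cos (a * t + \<theta>))\<^sup>2) / C\<^sup>2"
    using C by (simp add: u field_simps)
  have "sin (wave a b \<theta> x t) = 4 * u * (1 - u\<^sup>2) / (1 + u\<^sup>2)\<^sup>2"
    unfolding wave_def u_def by (rule sin_4_arctan)
  also have "\<dots> = 4 * (b * cos (a * t + \<theta>)) * C * (C\<^sup>2 - b\<^sup>2 * (cos (a * t + \<theta>))\<^sup>2)
      / (wave_denom a b \<theta> x t)\<^sup>2"
    unfolding 1 2 unfolding u using C by (simp add: power2_eq_square)
  finally show ?thesis by (simp add: C_def power_mult_distrib mult_ac)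
qed

lemma sine_gordon_wave:
  assumes ab: "a\<^sup>2 + b\<^sup>2 = 1"
  shows "sine_gordon (wave a b \<theta>)"
proof -
  have "wave_tt a b \<theta> x t - wave_xx a b \<theta> x t + sin (wave a b \<theta> x t) = 0" for x t
  proof -
    define Q c d C S where defs: "Q = wave_denom a b \<theta> x t" "c = cos (a * t + \<theta>)"
      "d = sin (a * t + \<theta>)" "C = cosh (b * x)" "S = sinh (b * x)"
    have Q: "Q = b\<^sup>2 * c\<^sup>2 + a\<^sup>2 * C\<^sup>2" by (simp add: defs wave_denom_def)
    have d: "d\<^sup>2 = 1 - c\<^sup>2" by (simp add: defs sin_squared_eq)
    have S: "S\<^sup>2 = C\<^sup>2 - 1" by (simp add: defs sinh_square_eq)
    have b: "b\<^sup>2 = 1 - a\<^sup>2" using ab by simp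
    \<comment> \<open>This bracket remains once the common factor
      \<open>4 * a * b * c * C / Q\<^sup>2\<close> is taken out. Eliminating \<open>d\<close>,
      \<open>S\<close> and \<open>b\<^sup>2\<close> leaves a polynomial identity.\<close>
    have cancel: "- a\<^sup>2 * (Q + 2 * b\<^sup>2 * d\<^sup>2) + b\<^sup>2 * (Q - 2 * a\<^sup>2 * S\<^sup>2)
        + (a\<^sup>2 * C\<^sup>2 - b\<^sup>2 * c\<^sup>2) = 0"
      unfolding Q d S b by algebra
    have "wave_tt a b \<theta> x t - wave_xx a b \<theta> x t + sin (wave a b \<theta> x t)
        = 4 * a * b * c * C / Q\<^sup>2 * (- a\<^sup>2 * (Q + 2 * b\<^sup>2 * d\<^sup>2) + b\<^sup>2 * (Q - 2 * a\<^sup>2 * S\<^sup>2)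
        + (a\<^sup>2 * C\<^sup>2 - b\<^sup>2 * c\<^sup>2))"
      unfolding wave_tt_def wave_xx_def sin_wave defs[symmetric]
      by (simp add: diff_divide_distrib add_divide_distrib algebra_simps power2_eq_square power3_eq_cube)
    then show ?thesis by (simp only: cancel mult_zero_right)
  qed
  then show ?thesis
    by (simp add: sine_gordon_def C2_plane_wave dx_wave dt_wave dx_wave_x dt_wave_t)
qed

end

subsection \<open>Size of the data\<close>

text \<open>The integrand of the squared weighted norm of the breather's velocity at its zero
  crossing; the minus sign is kept to match that velocity literally.\<close>

definition sech_weight :: "real \<Rightarrow> real \<Rightarrow> real \<Rightarrow> real" where
  "sech_weight s b x = (japanese x powr s * (- 4 * b / cosh (b * x)))\<^sup>2"

lemma sech_weight_eq:
  "sech_weight s b x = (1 + x\<^sup>2) powr s * (16 * b\<^sup>2 / (cosh (b * x))\<^sup>2)"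
proof -
  have "japanese x \<ge> 0" by (simp add: japanese_def)
  then have "(japanese x powr s)\<^sup>2 = (japanese x)\<^sup>2 powr s"
    by (simp add: power2_eq_square powr_mult)
  also have "(japanese x)\<^sup>2 = 1 + x\<^sup>2" by (simp add: japanese_def)
  finally show ?thesis
    by (simp add: sech_weight_def power_mult_distrib power_divide)
qed

text \<open>Twice the quadratic Taylor bound for the exponential, combined with
  \<open>exp \<bar>y\<bar> \<le> 2 * cosh \<bar>y\<bar>\<close>, gives the factor
  \<open>4\<close>.\<close>

lemma one_plus_square_le_cosh: "1 + y\<^sup>2 \<le> 4 * cosh y" for y :: real
proof -
  have "1 + \<bar>y\<bar> + \<bar>y\<bar>\<^sup>2 / 2 \<le> exp \<bar>y\<bar>" by (rule exp_lower_Taylor_quadratic) simp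
  moreover have "exp \<bar>y\<bar> \<le> 2 * cosh \<bar>y\<bar>" by (simp add: cosh_def)
  ultimately show ?thesis by simp
qed

lemma square_powr: "(b\<^sup>2) powr s = b powr (2 * s)" if "b > 0" for b s :: real
  using that by (simp add: powr_powr flip: powr_numeral)

text \<open>With \<open>q = 1 + (b * x)\<^sup>2\<close>, the polynomial weight costs at most one
  factor \<open>q\<close> because \<open>s \<le> 1\<close>, while \<open>cosh\<close> squared gains
  \<open>q\<^sup>2 / 16\<close>. An integrable \<open>inverse q\<close> is left, and the two factors
  \<open>16\<close> give \<open>256\<close>.\<close>

lemma sech_weight_le:
  assumes b: "0 < b" "b \<le> 1" and s: "0 \<le> s" "s \<le> 1"
  shows "sech_weight s b x \<le> 256 * b powr (2 - 2 * s) * inverse (1 + (b * x)\<^sup>2)"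
proof -
  define q where "q = 1 + (b * x)\<^sup>2"
  have q: "q \<ge> 1" by (simp add: q_def)
  have "1 * b\<^sup>2 \<le> 1" using b by (simp add: power_le_one)
  then have "1 + x\<^sup>2 \<le> q / b\<^sup>2"
    using b by (simp add: q_def field_simps)
  then have "(1 + x\<^sup>2) powr s \<le> (q / b\<^sup>2) powr s"
    using s by (intro powr_mono2) auto
  also have "\<dots> = q powr s / b powr (2 * s)"
    using b q by (simp add: powr_divide square_powr)
  also have "\<dots> \<le> q / b powr (2 * s)"
    using powr_mono[of s 1 q] s q by (intro divide_right_mono) auto
  finally have 1: "(1 + x\<^sup>2) powr s \<le> q / b powr (2 * s)" .
  have c: "q\<^sup>2 \<le> 16 * (cosh (b * x))\<^sup>2"
    using power_mono[OF one_plus_square_le_cosh[of "b * x"], of 2]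
    by (simp add: q_def power_mult_distrib)
  have "sech_weight s b x \<le> q / b powr (2 * s) * (16 * b\<^sup>2 / (q\<^sup>2 / 16))"
    unfolding sech_weight_eq using c q b
    by (intro mult_mono 1 divide_left_mono) auto
  also have "\<dots> = 256 * (b\<^sup>2 / b powr (2 * s)) * inverse q"
    using q by (simp add: field_simps power2_eq_square)
  also have "b\<^sup>2 / b powr (2 * s) = b powr (2 - 2 * s)"
    using b by (simp add: powr_diff)
  finally show ?thesis by (simp add: q_def)
qed

text \<open>On this interval \<open>x\<close> is large enough for the weight to reach
  \<open>b powr (- 2 * s)\<close>, while \<open>b * x \<le> 2\<close> keeps \<open>cosh\<close>
  bounded.\<close>

lemma sech_weight_ge:
  assumes b: "0 < b" and s: "0 \<le> s" and x: "x \<in> {1 / b..2 / b}"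
  shows "16 / (cosh 2)\<^sup>2 * b powr (2 - 2 * s) \<le> sech_weight s b x"
proof -
  have x': "1 \<le> b * x" "b * x \<le> 2" "x > 0"
    using x b by (auto simp: field_simps intro: less_le_trans[of 0 "1 / b"])
  have "1 / b\<^sup>2 \<le> x\<^sup>2"
    using power_mono[OF x'(1), of 2] b by (simp add: field_simps power_mult_distrib)
  then have "1 / b\<^sup>2 \<le> 1 + x\<^sup>2" by simp
  then have "(1 / b\<^sup>2) powr s \<le> (1 + x\<^sup>2) powr s"
    using s by (intro powr_mono2) auto
  then have 1: "1 / b powr (2 * s) \<le> (1 + x\<^sup>2) powr s"
    using b by (simp add: powr_divide square_powr)
  have "cosh (b * x) \<le> cosh 2"
    using x' by (subst cosh_real_nonneg_le_iff) auto
  then have c: "(cosh (b * x))\<^sup>2 \<le> (cosh 2)\<^sup>2"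
    by (intro power_mono) auto
  have "1 / b powr (2 * s) * (16 * b\<^sup>2 / (cosh 2)\<^sup>2) \<le> sech_weight s b x"
    unfolding sech_weight_eq using c b by (intro mult_mono 1 divide_left_mono) auto
  moreover have "1 / b powr (2 * s) * (16 * b\<^sup>2 / (cosh 2)\<^sup>2) = 16 / (cosh 2)\<^sup>2 * b powr (2 - 2 * s)"
    using b by (simp add: powr_diff)
  ultimately show ?thesis by simp
qed

lemma sech_weight_measurable: "sech_weight s b \<in> borel_measurable borel"
proof -
  have [measurable]: "(\<lambda>x. cosh (b * x)) \<in> borel_measurable borel"
    by (intro borel_measurable_continuous_onI continuous_intros)
  show ?thesis unfolding sech_weight_def[abs_def] japanese_def by measurable
qed

lemma has_bochner_integral_inverse_1_plus_square_scaled: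
  assumes "b > 0"
  shows "has_bochner_integral lborel (\<lambda>x. inverse (1 + (b * x)\<^sup>2)) (pi / b)"
proof -
  have "has_bochner_integral lborel (\<lambda>x. inverse (1 + x\<^sup>2)) pi"
    using integrable_inverse_1_plus_square LBINT_inverse_1_plus_square
    by (simp add: has_bochner_integral_iff interval_lebesgue_integral_def set_integrable_def
        set_lebesgue_integral_def einterval_def)
  then have "has_bochner_integral lborel (\<lambda>x. inverse (1 + (0 + b * x)\<^sup>2)) (pi /\<^sub>R \<bar>b\<bar>)"
    using assms by (intro lborel_has_bochner_integral_real_affine_iff[THEN iffD1]) simp_all
  then show ?thesis using assms by (simp add: divide_inverse_commute)
qed

text \<open>The majorant integrates to a multiple of \<open>pi / b\<close> and the interval of the
  lower bound has length \<open>1 / b\<close>; either way one power of \<open>b\<close> is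
  lost.\<close>

lemma
  assumes b: "0 < b" "b \<le> 1" and s: "0 \<le> s" "s \<le> 1"
  shows integrable_sech_weight: "integrable lborel (sech_weight s b)"
    and sech_weight_integral_le: "(LINT x|lborel. sech_weight s b x) \<le> 256 * pi * b powr (1 - 2 * s)"
    and sech_weight_integral_ge: "16 / (cosh 2)\<^sup>2 * b powr (1 - 2 * s) \<le> (LINT x|lborel. sech_weight s b x)"
proof -
  note J = has_bochner_integral_inverse_1_plus_square_scaled[OF b(1), unfolded has_bochner_integral_iff]
  have nonneg: "0 \<le> sech_weight s b x" for x by (simp add: sech_weight_def)
  have e: "b powr (2 - 2 * s) / b = b powr (1 - 2 * s)"
    using powr_diff[of b "2 - 2 * s" 1] b by simp
  have Ji: "integrable lborel (\<lambda>x. 256 * b powr (2 - 2 * s) * inverse (1 + (b * x)\<^sup>2))"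
    using J by (intro integrable_mult_right) simp
  show int: "integrable lborel (sech_weight s b)"
    by (rule Bochner_Integration.integrable_bound[OF Ji])
       (use sech_weight_le[OF b s] nonneg sech_weight_measurable in \<open>auto simp: abs_of_nonneg\<close>)
  have "(LINT x|lborel. sech_weight s b x)
      \<le> (LINT x|lborel. 256 * b powr (2 - 2 * s) * inverse (1 + (b * x)\<^sup>2))"
    by (intro integral_mono int Ji sech_weight_le b s)
  also have "\<dots> = 256 * pi * (b powr (2 - 2 * s) / b)"
    using J by simp
  finally show "(LINT x|lborel. sech_weight s b x) \<le> 256 * pi * b powr (1 - 2 * s)"
    by (simp add: e)
  have "16 / (cosh 2)\<^sup>2 * (b powr (2 - 2 * s) / b)
      = (LINT x|lborel. indicator {1 / b..2 / b} x * (16 / (cosh 2)\<^sup>2 * b powr (2 - 2 * s)))"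
    using b by (simp add: measure_def divide_right_mono field_simps)
  also have "\<dots> \<le> (LINT x|lborel. sech_weight s b x)"
    using sech_weight_ge[OF b(1) s(1)] nonneg
    by (intro integral_mono int integrable_mult_left integrable_real_indicator)
       (auto simp: indicator_def emeasure_lborel_Icc_eq)
  finally show "16 / (cosh 2)\<^sup>2 * b powr (1 - 2 * s) \<le> (LINT x|lborel. sech_weight s b x)"
    by (simp add: e)
qed

section \<open>The breather data at the zero crossing\<close>

lemma breather_eq_wave: "breather b = wave (breather_freq b) b 0"
  by (simp add: breather_def wave_def fun_eq_iff)

lemma breather_freq_pos: "0 < b \<Longrightarrow> b < 1 \<Longrightarrow> breather_freq b > 0"
  by (simp add: breather_freq_def abs_square_less_1)

text \<open>The cosine vanishes and the sine is \<open>1\<close>. This serves both the breather at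
  its crossing time, with phase \<open>0\<close>, and the shifted wave at time
  \<open>0\<close>.\<close>

lemma wave_crossing:
  assumes "a > 0" and "a * t + \<theta> = pi / 2"
  shows "wave a b \<theta> x t = 0" and "wave_t a b \<theta> x t = - 4 * b / cosh (b * x)"
  using assms(1) unfolding wave_def wave_t_def wave_denom_def assms(2)
  by (simp_all add: power2_eq_square)

lemma breather_data_crossing:
  assumes "0 < b" "b < 1"
  shows "breather_data b (pi / (2 * breather_freq b)) = ((\<lambda>x. 0), (\<lambda>x. - 4 * b / cosh (b * x)))"
proof -
  have a: "breather_freq b > 0" using assms by (rule breather_freq_pos)
  then have "breather_freq b * (pi / (2 * breather_freq b)) + 0 = pi / 2" by simp
  from wave_crossing[OF a this] show ?thesis
    by (simp add: breather_data_def breather_eq_wave dt_wave[OF a])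
qed

text \<open>Only the velocity contributes to the size. Its integrand is Borel, so integrals pass
  from \<open>lebesgue\<close> to \<open>lborel\<close>.\<close>

lemma
  assumes b: "0 < b" "b < 1" and s: "0 \<le> s" "s \<le> 1"
  shows sech_data_in_space: "((\<lambda>x. 0), (\<lambda>x. - 4 * b / cosh (b * x))) \<in> H1s_sin s \<times> L2s s"
    and data_size_sech: "data_size s ((\<lambda>x. 0), (\<lambda>x. - 4 * b / cosh (b * x)))
      = sqrt (LINT x|lborel. sech_weight s b x)"
proof -
  have "(\<lambda>x. - 4 * b / cosh (b * x)) \<in> borel_measurable lebesgue"
    by (intro measurable_completion) (simp add: cosh_def)
  moreover have "integrable lebesgue (sech_weight s b)"
    using integrable_sech_weight[of b s] b s sech_weight_measurable by (simp add: integrable_completion)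
  ultimately have "(\<lambda>x. - 4 * b / cosh (b * x)) \<in> L2s s"
    by (simp add: L2s_def sech_weight_def[abs_def])
  then show "((\<lambda>x. 0), (\<lambda>x. - 4 * b / cosh (b * x))) \<in> H1s_sin s \<times> L2s s"
    using has_weak_deriv_zero weak_deriv_zero(1) by (auto simp: H1s_sin_def L2s_def)
  have "(L2s_norm s (\<lambda>x. - 4 * b / cosh (b * x)))\<^sup>2 = (LINT x|lebesgue. sech_weight s b x)"
    unfolding L2s_norm_def sech_weight_def by (intro real_sqrt_pow2 integral_nonneg_AE) simp
  also have "\<dots> = (LINT x|lborel. sech_weight s b x)"
    using sech_weight_measurable by (intro integral_completion) simp
  finally show "data_size s ((\<lambda>x. 0), (\<lambda>x. - 4 * b / cosh (b * x)))
      = sqrt (LINT x|lborel. sech_weight s b x)"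
    by (simp add: data_size_def weak_deriv_zero(2)) (simp add: L2s_norm_def)
qed

lemma data_size_sech_bounds:
  assumes b: "0 < b" "b < 1" and s: "0 \<le> s" "s \<le> 1"
  defines "D \<equiv> data_size s ((\<lambda>x. 0), (\<lambda>x. - 4 * b / cosh (b * x)))"
  shows "4 / cosh 2 * b powr (1 / 2 - s) \<le> D" and "D \<le> 32 * b powr (1 / 2 - s)"
proof -
  have p: "sqrt (b powr (1 - 2 * s)) = b powr (1 / 2 - s)"
    using b by (simp add: powr_powr field_simps flip: powr_half_sqrt)
  have D: "D = sqrt (LINT x|lborel. sech_weight s b x)"
    unfolding D_def using data_size_sech[OF b s] .
  have "sqrt (16 / (cosh 2)\<^sup>2 * b powr (1 - 2 * s)) \<le> D"
    unfolding D using b s by (intro real_sqrt_le_mono sech_weight_integral_ge) auto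
  then show "4 / cosh 2 * b powr (1 / 2 - s) \<le> D"
    by (simp add: real_sqrt_mult real_sqrt_divide p)
  have "D \<le> sqrt (256 * pi * b powr (1 - 2 * s))"
    unfolding D using b s by (intro real_sqrt_le_mono sech_weight_integral_le) auto
  \<comment> \<open>\<open>256 * pi\<close> is below \<open>256 * 4 = 32\<^sup>2\<close>.\<close>
  also have "\<dots> \<le> sqrt (32\<^sup>2 * b powr (1 - 2 * s))"
    using pi_less_4 by (intro real_sqrt_le_mono mult_right_mono) auto
  finally show "D \<le> 32 * b powr (1 / 2 - s)"
    by (simp only: real_sqrt_mult p real_sqrt_abs abs_numeral)
qed

subsection \<open>Instability\<close>

text \<open>The wave is periodic in time and returns to its largest profile, so its energy in the
  fixed window \<open>v = 0\<close>, \<open>L = 1\<close> stays away from \<open>0\<close> along a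
  sequence of times.\<close>

lemma wave_not_locally_decaying:
  assumes a: "a > 0" and b: "b > 0"
  shows "\<not> locally_decaying (wave a b \<theta>)"
proof
  assume "locally_decaying (wave a b \<theta>)"
  then have lim: "(local_energy (wave a b \<theta>) 0 1 \<longlongrightarrow> 0) at_top"
    by (simp add: locally_decaying_def)
  \<comment> \<open>At these times the cosine equals \<open>1\<close>.\<close>
  define T where "T k = (2 * real k * pi - \<theta>) / a" for k :: nat
  \<comment> \<open>The height of the largest profile at \<open>x = 1\<close>, its minimum over
    \<open>\<bar>x\<bar> \<le> 1\<close>.\<close>
  define c where "c = 4 * arctan (b / (a * cosh b))"
  have c: "c > 0" using a b by (simp add: c_def)
  have "filterlim T at_top sequentially"
    unfolding T_def using a by real_asymp
  with lim have "(\<lambda>k. local_energy (wave a b \<theta>) 0 1 (T k)) \<longlonglongrightarrow> 0"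
    by (rule filterlim_compose)
  moreover have "2 * c\<^sup>2 \<le> local_energy (wave a b \<theta>) 0 1 (T k)" for k
  proof -
    define e where "e x = (wave a b \<theta> x (T k))\<^sup>2 + (wave_x a b \<theta> x (T k))\<^sup>2 + (wave_t a b \<theta> x (T k))\<^sup>2" for x
    have I: "{x::real. \<bar>x - 0 * T k\<bar> < 1} = {-1<..<1}" by auto
    have "continuous_on {-1..1} e"
      unfolding e_def by (intro continuous_intros a)
    then have "e absolutely_integrable_on {-1..1}"
      by (rule absolutely_integrable_continuous_real)
    then have e: "e absolutely_integrable_on {-1<..<1}"
      by (rule set_integrable_subset) auto
    have le: "c\<^sup>2 \<le> e x" if "x \<in> {-1<..<1}" for x
    proof -
      have "\<bar>b * x\<bar> \<le> b" using that b by (auto simp: abs_mult)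
      then have "cosh (b * x) \<le> cosh b"
        using b cosh_real_nonneg_le_iff[of "\<bar>b * x\<bar>" b] by (simp only: abs_ge_zero cosh_real_abs)
      moreover have phase: "a * T k + \<theta> = 2 * real k * pi" using a by (simp add: T_def)
      have "wave a b \<theta> x (T k) = 4 * arctan (b / (a * cosh (b * x)))"
        unfolding wave_def phase cos_2npi by simp
      ultimately have "c \<le> wave a b \<theta> x (T k)"
        using a b by (auto simp: c_def arctan_le_iff intro!: divide_left_mono mult_left_mono)
      then have "c\<^sup>2 \<le> (wave a b \<theta> x (T k))\<^sup>2"
        using c by (intro power_mono) auto
      then show ?thesis by (simp add: e_def add_increasing2)
    qed
    have "2 * c\<^sup>2 = (LINT x:{-1<..<1::real}|lebesgue. c\<^sup>2)"
      by (simp add: set_lebesgue_integral_def)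
    also have "\<dots> \<le> (LINT x:{-1<..<1}|lebesgue. e x)"
      using e le by (intro set_integral_mono) (auto simp: set_integrable_def)
    also have "\<dots> = local_energy (wave a b \<theta>) 0 1 (T k)"
      by (simp only: local_energy_def I dx_wave[OF a] dt_wave[OF a] e_def)
    finally show ?thesis .
  qed
  ultimately have "2 * c\<^sup>2 \<le> 0" using LIMSEQ_le_const by blast
  with c show False by simp
qed

theorem proposition1p10:
  fixes s :: real
  assumes "0 \<le> s" and "s < 1 / 2"
  shows "(\<exists>C>0. \<exists>\<beta>\<^sub>0>0. \<beta>\<^sub>0 \<le> 1 \<and> (\<forall>\<beta>. 0 < \<beta> \<and> \<beta> < \<beta>\<^sub>0 \<longrightarrow>
            breather_data \<beta> (pi / (2 * breather_freq \<beta>)) \<in> H1s_sin s \<times> L2s s \<and>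
            inverse C * \<beta> powr (1 / 2 - s)
              \<le> data_size s (breather_data \<beta> (pi / (2 * breather_freq \<beta>))) \<and>
            data_size s (breather_data \<beta> (pi / (2 * breather_freq \<beta>)))
              \<le> C * \<beta> powr (1 / 2 - s)))
       \<and> (\<forall>\<epsilon>>0. \<exists>g \<in> H1s_sin s \<times> L2s s. data_size s g < \<epsilon> \<and>
            (\<exists>f. sine_gordon_solution g f \<and> \<not> locally_decaying f))"
proof (intro conjI allI impI)
  have s: "0 \<le> s" "s \<le> 1" using assms by auto
  show "\<exists>C>0. \<exists>\<beta>\<^sub>0>0. \<beta>\<^sub>0 \<le> 1 \<and> (\<forall>\<beta>. 0 < \<beta> \<and> \<beta> < \<beta>\<^sub>0 \<longrightarrow>
            breather_data \<beta> (pi / (2 * breather_freq \<beta>)) \<in> H1s_sin s \<times> L2s s \<and>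
            inverse C * \<beta> powr (1 / 2 - s)
              \<le> data_size s (breather_data \<beta> (pi / (2 * breather_freq \<beta>))) \<and>
            data_size s (breather_data \<beta> (pi / (2 * breather_freq \<beta>)))
              \<le> C * \<beta> powr (1 / 2 - s))"
  \<comment> \<open>The summand \<open>32\<close> covers the upper bound, and adding
    \<open>cosh 2\<close> brings the inverse below \<open>4 / cosh 2\<close>. Every
    \<open>\<beta>\<close> below \<open>1\<close> is small enough.\<close>
  proof (rule exI[of _ "32 + cosh 2"], intro conjI exI[of _ "1::real"] allI impI; (elim conjE)?)
    show "0 < 32 + cosh (2::real)" by (simp add: add_pos_pos)
    fix \<beta> :: real assume b: "0 < \<beta>" "\<beta> < 1"
    note D = data_size_sech_bounds[OF b s]
    show "breather_data \<beta> (pi / (2 * breather_freq \<beta>)) \<in> H1s_sin s \<times> L2s s"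
      unfolding breather_data_crossing[OF b] by (rule sech_data_in_space[OF b s])
    have "inverse (32 + cosh 2) \<le> 4 / cosh (2::real)"
      by (simp add: field_simps add_pos_pos)
    then have "inverse (32 + cosh 2) * \<beta> powr (1 / 2 - s) \<le> 4 / cosh 2 * \<beta> powr (1 / 2 - s)"
      by (intro mult_right_mono) auto
    also note D(1)
    finally show "inverse (32 + cosh 2) * \<beta> powr (1 / 2 - s)
        \<le> data_size s (breather_data \<beta> (pi / (2 * breather_freq \<beta>)))"
      unfolding breather_data_crossing[OF b] .
    note D(2)
    also have "32 * \<beta> powr (1 / 2 - s) \<le> (32 + cosh 2) * \<beta> powr (1 / 2 - s)"
      by (intro mult_right_mono) auto
    finally show "data_size s (breather_data \<beta> (pi / (2 * breather_freq \<beta>)))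
        \<le> (32 + cosh 2) * \<beta> powr (1 / 2 - s)"
      unfolding breather_data_crossing[OF b] .
  qed auto
next
  have s: "0 \<le> s" "s \<le> 1" using assms by auto
  fix \<epsilon> :: real assume "\<epsilon> > 0"
  \<comment> \<open>The exponent is positive exactly because \<open>s < 1 / 2\<close>.\<close>
  have "((\<lambda>b. 32 * b powr (1 / 2 - s)) \<longlongrightarrow> 0) (at_right 0)"
    using assms by real_asymp
  then have "\<forall>\<^sub>F b in at_right 0. 32 * b powr (1 / 2 - s) < \<epsilon>"
    using \<open>\<epsilon> > 0\<close> by (rule order_tendstoD)
  moreover have "\<forall>\<^sub>F b in at_right 0. b \<in> {0<..<1::real}"
    by (rule eventually_at_right_real) simp
  ultimately have "\<forall>\<^sub>F b in at_right 0. 32 * b powr (1 / 2 - s) < \<epsilon> \<and> b \<in> {0<..<1}"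
    by (rule eventually_conj)
  then obtain b where b: "0 < b" "b < 1" and small: "32 * b powr (1 / 2 - s) < \<epsilon>"
    using eventually_happens[of _ "at_right (0::real)"] by (auto simp: trivial_limit_at_right_real)
  define a where "a = breather_freq b"
  have a: "a > 0" unfolding a_def using b by (rule breather_freq_pos)
  have ab: "a\<^sup>2 + b\<^sup>2 = 1"
    using b by (simp add: a_def breather_freq_def power_le_one)
  define g where "g = ((\<lambda>x::real. 0::real), (\<lambda>x. - 4 * b / cosh (b * x)))"
  \<comment> \<open>Phase \<open>pi / 2\<close> is the breather advanced by
    \<open>pi / (2 * a)\<close> in time, so the zero crossing provides the initial data.\<close>
  have "sine_gordon_solution g (wave a b (pi / 2))"
    using sine_gordon_wave[OF a ab] wave_crossing[OF a, of 0 "pi / 2"]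
    by (simp add: sine_gordon_solution_def g_def dt_wave[OF a])
  moreover have "data_size s g < \<epsilon>"
    using data_size_sech_bounds(2)[OF b s] small by (simp add: g_def)
  moreover have "g \<in> H1s_sin s \<times> L2s s"
    unfolding g_def by (rule sech_data_in_space[OF b s])
  ultimately show "\<exists>g \<in> H1s_sin s \<times> L2s s. data_size s g < \<epsilon> \<and>
            (\<exists>f. sine_gordon_solution g f \<and> \<not> locally_decaying f)"
    using wave_not_locally_decaying[OF a b(1)] by blast
qed

end
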